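(* Let $G$ be a group whose core quandle $\mathrm{Core}(G)$ is non-trivial. Then $\chi^{\mathrm{Qdle}}(\mathrm{Core}(G)) = 0$.
   Context: A quandle is a pair $(X,s)$ of a non-empty set $X$ and a map $s : X \to \mathrm{Map}(X,X)$, $x \mapsto s_x$ (where $\mathrm{Map}(X,X)$ is the set of all maps $X\to X$) such that: (1) $s_x(x)=x$ for all $x\in X$; (2) each $s_x$ is a bijection; (3) $s_x\circ s_y = s_{s_x(y)}\circ s_x$ for all $x,y\in X$. A quandle is trivial if $s_x=\mathrm{id}_X$ for all $x\in X$, and non-trivial otherwise. The displacement group $\mathrm{Dis}(X)$ is the group of bijections of $X$ generated under composition by $\{s_x\circ s_y^{-1} \mid x,y\in X\}$. For $g\in \mathrm{Dis}(X)$, $\mathrm{Fix}(g,X)=\{x\in X\mid g(x)=x\}$. The quandle Euler characteristic is $\chi^{\mathrm{Qdle}}(X)=\inf\{\#\mathrm{Fix}(g,X)\mid g\in \mathrm{Dis}(X)\}$, where $\#$ denotes cardinality. For a group $G$, the core quandle $\mathrm{Core}(G)$ is the quandle $(G,s)$ with $s_h(g)=hg^{-1}h$ for $g,h\in G$. *)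

theory Defs
  imports "HOL-Algebra.Bij" "HOL-Algebra.Generated_Groups" "HOL-Library.Extended_Nat"
begin

record 'a quandle_struct = "'a partial_object" +
  point_sym :: "'a \<Rightarrow> 'a \<Rightarrow> 'a" (\<open>\<s>\<index>\<close>)

text \<open>
  As in \<^const>\<open>Bij\<close>, self-maps of the carrier are represented by
  extensional functions, so that equality of maps is HOL equality.
\<close>

locale quandle =
  fixes X (structure)
  assumes carrier_nonempty: "carrier X \<noteq> {}"
    and idem: "x \<in> carrier X \<Longrightarrow> \<s> x x = x"
    and bij: "x \<in> carrier X \<Longrightarrow> \<s> x \<in> Bij (carrier X)"
    and self_distrib: "\<lbrakk>x \<in> carrier X; y \<in> carrier X\<rbrakk> \<Longrightarrow>
      compose (carrier X) (\<s> x) (\<s> y) = compose (carrier X) (\<s> (\<s> x y)) (\<s> x)"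

definition trivial_quandle :: "('a, 'b) quandle_struct_scheme \<Rightarrow> bool" where
  "trivial_quandle X \<longleftrightarrow>
    quandle X \<and> (\<forall>x\<in>carrier X. \<s>\<^bsub>X\<^esub> x = (\<lambda>y\<in>carrier X. y))"

definition nontrivial_quandle :: "('a, 'b) quandle_struct_scheme \<Rightarrow> bool" where
  "nontrivial_quandle X \<longleftrightarrow> quandle X \<and> \<not> trivial_quandle X"

definition Dis :: "('a, 'b) quandle_struct_scheme \<Rightarrow> ('a \<Rightarrow> 'a) set" where
  "Dis X = generate (BijGroup (carrier X))
     {\<s>\<^bsub>X\<^esub> x \<otimes>\<^bsub>BijGroup (carrier X)\<^esub> inv\<^bsub>BijGroup (carrier X)\<^esub> (\<s>\<^bsub>X\<^esub> y)
       | x y. x \<in> carrier X \<and> y \<in> carrier X}"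

definition Fix :: "('a \<Rightarrow> 'a) \<Rightarrow> ('a, 'b) quandle_struct_scheme \<Rightarrow> 'a set" where
  "Fix g X = {x \<in> carrier X. g x = x}"

text \<open>
  The function \<^const>\<open>card\<close> is \<open>0\<close> on infinite sets, so cardinalities are taken
  in \<^typ>\<open>enat\<close>, every infinite set having cardinality \<open>\<infinity>\<close>.
\<close>

definition ecard :: "'a set \<Rightarrow> enat" where
  "ecard A = (if finite A then enat (card A) else \<infinity>)"

definition quandle_euler_char :: "('a, 'b) quandle_struct_scheme \<Rightarrow> enat" (\<open>\<chi>\<^sub>Q\<close>) where
  "\<chi>\<^sub>Q X = (INF g\<in>Dis X. ecard (Fix g X))"

definition Core :: "('a, 'b) monoid_scheme \<Rightarrow> 'a quandle_struct" where
  "Core G =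
    \<lparr>carrier = carrier G,
     point_sym = (\<lambda>h\<in>carrier G. \<lambda>g\<in>carrier G. h \<otimes>\<^bsub>G\<^esub> inv\<^bsub>G\<^esub> g \<otimes>\<^bsub>G\<^esub> h)\<rparr>"

lemma quandle_Core:
  fixes G (structure)
  assumes "group G"
  shows "quandle (Core G)"
proof -
  interpret group G by fact
  have invol: "h \<otimes> inv (h \<otimes> inv g \<otimes> h) \<otimes> h = g"
    if "h \<in> carrier G" "g \<in> carrier G" for g h
  proof -
    have "h \<otimes> inv (h \<otimes> inv g \<otimes> h) \<otimes> h = (h \<otimes> inv h) \<otimes> g \<otimes> (inv h \<otimes> h)"
      using that by (simp only: inv_mult_group inv_inv m_assoc m_closed inv_closed)
    then show ?thesis using that by simp
  qed
  have cancel: "y \<otimes> (inv y \<otimes> z) = z" "inv y \<otimes> (y \<otimes> z) = z"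
    if "y \<in> carrier G" "z \<in> carrier G" for y z
    using that by (simp_all add: m_assoc [symmetric])
  show ?thesis
  proof
    show "carrier (Core G) \<noteq> {}"
      using one_closed by (auto simp: Core_def)
  next
    fix x assume "x \<in> carrier (Core G)"
    then show "\<s>\<^bsub>Core G\<^esub> x x = x"
      by (simp add: Core_def)
  next
    fix x assume x: "x \<in> carrier (Core G)"
    have "bij_betw (\<lambda>g\<in>carrier G. x \<otimes> inv g \<otimes> x) (carrier G) (carrier G)"
      by (rule bij_betwI [where g = "\<lambda>g\<in>carrier G. x \<otimes> inv g \<otimes> x"])
        (use x in \<open>auto simp: Core_def invol\<close>)
    with x show "\<s>\<^bsub>Core G\<^esub> x \<in> Bij (carrier (Core G))"
      by (simp add: Core_def Bij_def)
  next
    fix x y assume "x \<in> carrier (Core G)" "y \<in> carrier (Core G)"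
    then show "compose (carrier (Core G)) (\<s>\<^bsub>Core G\<^esub> x) (\<s>\<^bsub>Core G\<^esub> y)
        = compose (carrier (Core G)) (\<s>\<^bsub>Core G\<^esub> (\<s>\<^bsub>Core G\<^esub> x y)) (\<s>\<^bsub>Core G\<^esub> x)"
      by (auto simp: Core_def compose_def fun_eq_iff restrict_def
          inv_mult_group m_assoc cancel)
  qed
qed

end

theory Submission
  imports Defs
begin

text \<open>
  Since \<open>s\<^sub>1\<close> is inversion, \<open>s\<^sub>h \<circ> s\<^sub>1\<inverse>\<close> is the map \<open>g \<mapsto> h g h\<close>, and hence the displacement
  group of \<open>Core(G)\<close> contains every \<open>g \<mapsto> (h\<^sub>1 \<cdots> h\<^sub>n) g (h\<^sub>n \<cdots> h\<^sub>1)\<close>.  The Euler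
  characteristic vanishes as soon as one of these maps is a translation \<open>g \<mapsto> g c\<close> with
  \<open>c \<noteq> 1\<close>, because such a translation has no fixed point.

  If \<open>h\<close> and \<open>k\<close> do not commute, the word \<open>h, k, (h k)\<inverse>\<close> has product \<open>1\<close>, while its reversal
  has product \<open>c = (h k)\<inverse> k h \<noteq> 1\<close> (lemma \<open>commutator_translation_in_Dis_Core\<close>).
  If \<open>G\<close> is abelian, \<open>g \<mapsto> h g h\<close> is translation by \<open>h\<^sup>2\<close>; and non-triviality provides
  \<open>x, y\<close> with \<open>x y\<inverse> x \<noteq> y\<close>, which says that \<open>h = x y\<inverse>\<close> has \<open>h\<^sup>2 \<noteq> 1\<close>.
\<close>

text \<open>The maps are cut off outside the carrier, as the elements of \<^const>\<open>Bij\<close> are.\<close>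

definition two_sided_mult :: "('a, 'b) monoid_scheme \<Rightarrow> 'a \<Rightarrow> 'a \<Rightarrow> 'a \<Rightarrow> 'a" where
  "two_sided_mult G a b = (\<lambda>g\<in>carrier G. a \<otimes>\<^bsub>G\<^esub> g \<otimes>\<^bsub>G\<^esub> b)"

lemma carrier_Core [simp]: "carrier (Core G) = carrier G"
  by (simp add: Core_def)

context group
begin

lemma compose_two_sided_mult:
  assumes "a \<in> carrier G" "b \<in> carrier G" "c \<in> carrier G" "d \<in> carrier G"
  shows "compose (carrier G) (two_sided_mult G a b) (two_sided_mult G c d)
    = two_sided_mult G (a \<otimes> c) (d \<otimes> b)"
proof
  show "compose (carrier G) (two_sided_mult G a b) (two_sided_mult G c d) g
    = two_sided_mult G (a \<otimes> c) (d \<otimes> b) g" for g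
    using assms by (cases "g \<in> carrier G") (simp_all add: two_sided_mult_def compose_def m_assoc)
qed

lemma two_sided_mult_Bij:
  assumes [simp]: "a \<in> carrier G" "b \<in> carrier G"
  shows "two_sided_mult G a b \<in> Bij (carrier G)"
proof -
  have "bij_betw (two_sided_mult G a b) (carrier G) (carrier G)"
  proof (rule bij_betwI [where g = "two_sided_mult G (inv a) (inv b)"])
    show "two_sided_mult G (inv a) (inv b) (two_sided_mult G a b g) = g"
      if "g \<in> carrier G" for g
      using fun_cong [OF compose_two_sided_mult [of "inv a" "inv b" a b], of g] that
      by (simp add: compose_def) (simp add: two_sided_mult_def)
    show "two_sided_mult G a b (two_sided_mult G (inv a) (inv b) g) = g"
      if "g \<in> carrier G" for g
      using fun_cong [OF compose_two_sided_mult [of a b "inv a" "inv b"], of g] that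
      by (simp add: compose_def) (simp add: two_sided_mult_def)
  qed (auto simp: two_sided_mult_def)
  then show ?thesis
    by (simp add: Bij_def two_sided_mult_def)
qed

lemma mult_two_sided_mult:
  assumes "a \<in> carrier G" "b \<in> carrier G" "c \<in> carrier G" "d \<in> carrier G"
  shows "two_sided_mult G a b \<otimes>\<^bsub>BijGroup (carrier G)\<^esub> two_sided_mult G c d
    = two_sided_mult G (a \<otimes> c) (d \<otimes> b)"
  using assms by (simp add: BijGroup_def two_sided_mult_Bij compose_two_sided_mult)

lemma point_sym_Core_Bij:
  assumes "x \<in> carrier G"
  shows "\<s>\<^bsub>Core G\<^esub> x \<in> Bij (carrier G)"
  using quandle.bij [OF quandle_Core [OF is_group], of x] assms by simp

lemma inv_point_sym_Core_one:
  "inv\<^bsub>BijGroup (carrier G)\<^esub> (\<s>\<^bsub>Core G\<^esub> \<one>) = \<s>\<^bsub>Core G\<^esub> \<one>"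
proof (rule group.inv_equality [OF group_BijGroup])
  have "compose (carrier G) (\<s>\<^bsub>Core G\<^esub> \<one>) (\<s>\<^bsub>Core G\<^esub> \<one>) = (\<lambda>g\<in>carrier G. g)"
    by (simp add: compose_def Core_def cong: restrict_cong)
  then show "\<s>\<^bsub>Core G\<^esub> \<one> \<otimes>\<^bsub>BijGroup (carrier G)\<^esub> \<s>\<^bsub>Core G\<^esub> \<one> = \<one>\<^bsub>BijGroup (carrier G)\<^esub>"
    by (simp add: BijGroup_def point_sym_Core_Bij)
qed (simp_all add: BijGroup_def point_sym_Core_Bij)

text \<open>These maps arise as \<open>s\<^sub>h \<circ> s\<^sub>1\<inverse>\<close>.\<close>

lemma two_sided_mult_in_Dis_Core:
  assumes h: "h \<in> carrier G"
  shows "two_sided_mult G h h \<in> Dis (Core G)"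
proof -
  have "two_sided_mult G h h = compose (carrier G) (\<s>\<^bsub>Core G\<^esub> h) (\<s>\<^bsub>Core G\<^esub> \<one>)"
  proof
    show "two_sided_mult G h h g = compose (carrier G) (\<s>\<^bsub>Core G\<^esub> h) (\<s>\<^bsub>Core G\<^esub> \<one>) g" for g
      using h by (cases "g \<in> carrier G") (simp_all add: two_sided_mult_def compose_def Core_def)
  qed
  then have "two_sided_mult G h h
    = \<s>\<^bsub>Core G\<^esub> h \<otimes>\<^bsub>BijGroup (carrier G)\<^esub> inv\<^bsub>BijGroup (carrier G)\<^esub> (\<s>\<^bsub>Core G\<^esub> \<one>)"
    unfolding inv_point_sym_Core_one
    using h by (simp add: BijGroup_def point_sym_Core_Bij)
  then show ?thesis
    unfolding Dis_def carrier_Core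
    using h one_closed by (intro generate.incl) blast
qed

text \<open>
  In \<open>g \<mapsto> h k m g m k h\<close> the same factors occur on both sides in opposite order, so
  \<open>m = (h k)\<inverse>\<close> cancels the left factor and leaves a commutator on the right.
\<close>

lemma commutator_translation_in_Dis_Core:
  assumes [simp]: "h \<in> carrier G" "k \<in> carrier G"
  shows "two_sided_mult G \<one> (inv (h \<otimes> k) \<otimes> (k \<otimes> h)) \<in> Dis (Core G)"
proof -
  let ?m = "inv (h \<otimes> k)"
  have "two_sided_mult G h h \<otimes>\<^bsub>BijGroup (carrier G)\<^esub> two_sided_mult G k k
      \<otimes>\<^bsub>BijGroup (carrier G)\<^esub> two_sided_mult G ?m ?m \<in> Dis (Core G)"
    using two_sided_mult_in_Dis_Core [of h] two_sided_mult_in_Dis_Core [of k]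
      two_sided_mult_in_Dis_Core [of ?m]
    unfolding Dis_def carrier_Core by (auto intro: generate.eng)
  then show ?thesis
    by (simp add: mult_two_sided_mult)
qed

lemma quandle_euler_char_Core_eq_0I:
  assumes c: "c \<in> carrier G" "c \<noteq> \<one>" and Dis: "two_sided_mult G \<one> c \<in> Dis (Core G)"
  shows "\<chi>\<^sub>Q (Core G) = 0"
proof -
  have "Fix (two_sided_mult G \<one> c) (Core G) = {}"
    using c by (auto simp: Fix_def two_sided_mult_def)
  then have "ecard (Fix (two_sided_mult G \<one> c) (Core G)) = 0"
    by (simp add: ecard_def zero_enat_def)
  then have "\<chi>\<^sub>Q (Core G) \<le> 0"
    unfolding quandle_euler_char_def using INF_lower [OF Dis] by metis
  then show ?thesis by simp
qed

lemma nontrivial_quandle_CoreE: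
  assumes "nontrivial_quandle (Core G)"
  obtains x y where "x \<in> carrier G" "y \<in> carrier G" "x \<otimes> inv y \<otimes> x \<noteq> y"
proof -
  have "\<exists>x\<in>carrier G. \<s>\<^bsub>Core G\<^esub> x \<noteq> (\<lambda>y\<in>carrier G. y)"
    using assms by (auto simp: nontrivial_quandle_def trivial_quandle_def)
  then show thesis
    using that by (auto simp: Core_def fun_eq_iff restrict_def split: if_splits)
qed

end

theorem theorem1p5:
  fixes G :: "('a, 'b) monoid_scheme"
  assumes "group G"
    and "nontrivial_quandle (Core G)"
  shows "\<chi>\<^sub>Q (Core G) = 0"
proof -
  interpret group G by fact
  show ?thesis
  proof (cases "\<forall>h\<in>carrier G. \<forall>k\<in>carrier G. h \<otimes>\<^bsub>G\<^esub> k = k \<otimes>\<^bsub>G\<^esub> h")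
    case True
    obtain x y where [simp]: "x \<in> carrier G" "y \<in> carrier G"
      and ne: "x \<otimes>\<^bsub>G\<^esub> inv\<^bsub>G\<^esub> y \<otimes>\<^bsub>G\<^esub> x \<noteq> y"
      using nontrivial_quandle_CoreE [OF assms(2)] .
    define h where "h = x \<otimes>\<^bsub>G\<^esub> inv\<^bsub>G\<^esub> y"
    have h [simp]: "h \<in> carrier G"
      by (simp add: h_def)
    have "h \<otimes>\<^bsub>G\<^esub> h \<noteq> \<one>\<^bsub>G\<^esub>"
    proof
      assume "h \<otimes>\<^bsub>G\<^esub> h = \<one>\<^bsub>G\<^esub>"
      then have "(h \<otimes>\<^bsub>G\<^esub> x) \<otimes>\<^bsub>G\<^esub> inv\<^bsub>G\<^esub> y = \<one>\<^bsub>G\<^esub>"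
        by (simp add: h_def m_assoc)
      then show False
        using ne inv_equality [of "h \<otimes>\<^bsub>G\<^esub> x" "inv\<^bsub>G\<^esub> y"] by (simp add: h_def)
    qed
    moreover have "two_sided_mult G h h = two_sided_mult G \<one>\<^bsub>G\<^esub> (h \<otimes>\<^bsub>G\<^esub> h)"
      unfolding two_sided_mult_def
    proof (rule restrict_ext)
      fix g assume g: "g \<in> carrier G"
      have "h \<otimes>\<^bsub>G\<^esub> g \<otimes>\<^bsub>G\<^esub> h = g \<otimes>\<^bsub>G\<^esub> h \<otimes>\<^bsub>G\<^esub> h"
        using True g h by metis
      then show "h \<otimes>\<^bsub>G\<^esub> g \<otimes>\<^bsub>G\<^esub> h = \<one>\<^bsub>G\<^esub> \<otimes>\<^bsub>G\<^esub> g \<otimes>\<^bsub>G\<^esub> (h \<otimes>\<^bsub>G\<^esub> h)"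
        using g by (simp add: m_assoc)
    qed
    ultimately show ?thesis
      using two_sided_mult_in_Dis_Core [OF h]
      by (intro quandle_euler_char_Core_eq_0I [of "h \<otimes>\<^bsub>G\<^esub> h"]) simp_all
  next
    case False
    then obtain h k where hk [simp]: "h \<in> carrier G" "k \<in> carrier G"
      and ne: "h \<otimes>\<^bsub>G\<^esub> k \<noteq> k \<otimes>\<^bsub>G\<^esub> h"
      by blast
    have "inv\<^bsub>G\<^esub> (h \<otimes>\<^bsub>G\<^esub> k) \<otimes>\<^bsub>G\<^esub> (k \<otimes>\<^bsub>G\<^esub> h) \<noteq> \<one>\<^bsub>G\<^esub>"
      using ne inv_solve_left' [of "\<one>\<^bsub>G\<^esub>" "h \<otimes>\<^bsub>G\<^esub> k" "k \<otimes>\<^bsub>G\<^esub> h"] by auto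
    then show ?thesis
      using commutator_translation_in_Dis_Core [OF hk]
      by (intro quandle_euler_char_Core_eq_0I) simp_all
  qed
qed

end
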